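(* Let $\Sigma$ be a set of formulae closed under subformulae, let $\mathfrak{J}=\langle W,\mathcal{A},\{R_X:X\in\mathcal{A}\},\nu\rangle$ be a Kripke $\mathbf{LCR}$ model, and let $\mathfrak{J}^*$ be a filtration of $\mathfrak{J}$ through $\Sigma$. Then for every $\phi\in\Sigma$, every $x\in W$ and every $a\in\mathcal{T}$: $\nu_x(\phi)=a$ if and only if $\nu^*_{[x]}(\phi)=a$. That is, $[|\phi|]=|\phi|^*$ for every $\phi\in\Sigma$.
   Context: Fix an integer $m\ge 2$ and let $\mathcal{T}=\{0,\frac{1}{m-1},\dots,\frac{m-2}{m-1},1\}$ with its natural order. For $a,b\in\mathcal{T}$ put $\sim a=1-a$, $a\rightarrow b=\min\{1,1-a+b\}$. The language $\mathcal{L}_{\succ}$ has a countable set $\Pi$ of propositional variables, the unary connective $\neg$ and the binary connectives $\rightarrow$ and $\succ$. A Kripke $\mathbf{LCR}$ model is $\mathfrak{J}=\langle W,\mathcal{A},\{R_X:X\in\mathcal{A}\},\nu\rangle$ with $W$ a nonempty set, $\mathcal{A}\subseteq(\mathcal{P}(W))^m$, each $R_X:W\times W\to\mathcal{T}$ (write $xR_Xy$), and $\nu:\Pi\times W\to\mathcal{T}$ (write $\nu_x(p)$), extended to all formulae by $\nu_x(\neg\phi)=\sim\nu_x(\phi)$, $\nu_x(\phi\rightarrow\psi)=\nu_x(\phi)\rightarrow\nu_x(\psi)$, $\nu_x(\phi\succ\psi)=\bigwedge\{xR_{|\phi|}y\rightarrow\nu_y(\psi):y\in W\}$, where $|\phi|=(|\phi|_1,\dots,|\phi|_m)$,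 $|\phi|_i=\{x\in W:\nu_x(\phi)=\frac{i-1}{m-1}\}$ (the semantics presupposes $|\phi|\in\mathcal{A}$). Filtration: for $\Sigma$ closed under subformulae, define $x\equiv y$ iff for every $\phi\in\Sigma$ and $a\in\mathcal{T}$, $\nu_x(\phi)=a$ iff $\nu_y(\phi)=a$; let $[x]$ be the $\equiv$-class of $x$ and $[W]$ the set of classes. For $X=(X_1,\dots,X_m)\in\mathcal{A}$ put $[X]=([X]_1,\dots,[X]_m)$ with $[X]_i=\{[x]:x\in X_i\}\subseteq[W]$, and $[\mathcal{A}]=\{[X]:X\in\mathcal{A}\}$. A filtration of $\mathfrak{J}$ through $\Sigma$ is any model $\mathfrak{J}^*=\langle W^*,\mathcal{A}^*,\{R^*_{X^*}:X^*\in\mathcal{A}^*\},\nu^*\rangle$ with $W^*=[W]$, $\mathcal{A}^*=[\mathcal{A}]$, $\nu^*:\Pi\times W^*\to\mathcal{T}$ and each $R^*_{X^*}:W^*\times W^*\to\mathcal{T}$, such that (a) $\nu^*_{[y]}(p)=\nu_y(p)$ whenever $p\in\Sigma$; (b) $[x]R^*_{[X]}[y]=\bigvee\{x'R_Xy':x'\in[x],\ y'\in[y]\}$ (supremum). $|\phi|^*$ denotes the proposition expressed by $\phi$ in $\mathfrak{J}^*$, and $[|\phi|]$ is $[X]$ for $X=|\phi|$. *)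

theory Defs
  imports Complex_Main "HOL-Library.Countable"
begin

definition truth_values :: "nat \<Rightarrow> real set" where
  "truth_values m = (\<lambda>k. real k / (real m - 1)) ` {0..<m}"

definition luk_neg :: "real \<Rightarrow> real" where
  "luk_neg a = 1 - a"

definition luk_imp :: "real \<Rightarrow> real \<Rightarrow> real" where
  "luk_imp a b = min 1 (1 - a + b)"

datatype 'p form =
    Var 'p
  | Neg "'p form"
  | Imp "'p form" "'p form"
  | Cond "'p form" "'p form"

primrec subformulae :: "'p form \<Rightarrow> 'p form set" where
  "subformulae (Var p) = {Var p}"
| "subformulae (Neg \<phi>) = insert (Neg \<phi>) (subformulae \<phi>)"
| "subformulae (Imp \<phi> \<psi>) = insert (Imp \<phi> \<psi>) (subformulae \<phi> \<union> subformulae \<psi>)"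
| "subformulae (Cond \<phi> \<psi>) = insert (Cond \<phi> \<psi>) (subformulae \<phi> \<union> subformulae \<psi>)"

definition subformula_closed :: "'p form set \<Rightarrow> bool" where
  "subformula_closed \<Sigma> \<longleftrightarrow> (\<forall>\<phi>\<in>\<Sigma>. subformulae \<phi> \<subseteq> \<Sigma>)"

text \<open>
  Elements of the m-th power of the powerset of W are lists of length m.
  The accessibility function is total; only its values at members of \<open>props\<close>
  and at worlds are constrained.
\<close>

record ('p, 'w) kripke =
  worlds :: "'w set"
  props :: "'w set list set"
  acc :: "'w set list \<Rightarrow> 'w \<Rightarrow> 'w \<Rightarrow> real"
  val :: "'p \<Rightarrow> 'w \<Rightarrow> real"

definition levels :: "nat \<Rightarrow> 'w set \<Rightarrow> ('w \<Rightarrow> real) \<Rightarrow> 'w set list" where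
  "levels m W f = map (\<lambda>i. {x \<in> W. f x = (real i - 1) / (real m - 1)}) [1..<Suc m]"

primrec eval :: "nat \<Rightarrow> ('p, 'w) kripke \<Rightarrow> 'p form \<Rightarrow> 'w \<Rightarrow> real" where
  "eval m J (Var p) x = val J p x"
| "eval m J (Neg \<phi>) x = luk_neg (eval m J \<phi> x)"
| "eval m J (Imp \<phi> \<psi>) x = luk_imp (eval m J \<phi> x) (eval m J \<psi> x)"
| "eval m J (Cond \<phi> \<psi>) x =
     (INF y\<in>worlds J. luk_imp (acc J (levels m (worlds J) (eval m J \<phi>)) x y) (eval m J \<psi> y))"

definition truth_prop :: "nat \<Rightarrow> ('p, 'w) kripke \<Rightarrow> 'p form \<Rightarrow> 'w set list" where
  "truth_prop m J \<phi> = levels m (worlds J) (eval m J \<phi>)"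

definition lcr_structure :: "nat \<Rightarrow> ('p, 'w) kripke \<Rightarrow> bool" where
  "lcr_structure m J \<longleftrightarrow>
     worlds J \<noteq> {} \<and>
     props J \<subseteq> {X. length X = m \<and> set X \<subseteq> Pow (worlds J)} \<and>
     (\<forall>X\<in>props J. \<forall>x\<in>worlds J. \<forall>y\<in>worlds J. acc J X x y \<in> truth_values m) \<and>
     (\<forall>p. \<forall>x\<in>worlds J. val J p x \<in> truth_values m)"

text \<open>
  The second conjunct is what the semantics presupposes: the accessibility
  function is consulted only at members of \<open>props\<close>.
\<close>

definition lcr_model :: "nat \<Rightarrow> ('p, 'w) kripke \<Rightarrow> bool" where
  "lcr_model m J \<longleftrightarrow> lcr_structure m J \<and> (\<forall>\<phi>. truth_prop m J \<phi> \<in> props J)"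

definition filt_rel :: "nat \<Rightarrow> ('p, 'w) kripke \<Rightarrow> 'p form set \<Rightarrow> ('w \<times> 'w) set" where
  "filt_rel m J \<Sigma> = {(x, y). x \<in> worlds J \<and> y \<in> worlds J \<and>
     (\<forall>\<phi>\<in>\<Sigma>. \<forall>a\<in>truth_values m. eval m J \<phi> x = a \<longleftrightarrow> eval m J \<phi> y = a)}"

definition filt_class :: "nat \<Rightarrow> ('p, 'w) kripke \<Rightarrow> 'p form set \<Rightarrow> 'w \<Rightarrow> 'w set" where
  "filt_class m J \<Sigma> x = filt_rel m J \<Sigma> `` {x}"

definition filt_prop :: "nat \<Rightarrow> ('p, 'w) kripke \<Rightarrow> 'p form set \<Rightarrow> 'w set list \<Rightarrow> 'w set set list" where
  "filt_prop m J \<Sigma> X = map (\<lambda>Y. filt_class m J \<Sigma> ` Y) X"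

text \<open>
  A filtration is not required to contain the propositions of all formulae:
  for formulae in \<open>\<Sigma>\<close> this membership is a consequence of the defining
  conditions, and the values of other formulae play no role. A filtration that
  happens to satisfy \<open>lcr_model\<close> is in particular a filtration in this sense.
\<close>

definition filtration ::
  "nat \<Rightarrow> ('p, 'w) kripke \<Rightarrow> 'p form set \<Rightarrow> ('p, 'w set) kripke \<Rightarrow> bool" where
  "filtration m J \<Sigma> J' \<longleftrightarrow>
     lcr_structure m J' \<and>
     worlds J' = worlds J // filt_rel m J \<Sigma> \<and>
     props J' = filt_prop m J \<Sigma> ` props J \<and>
     (\<forall>p. Var p \<in> \<Sigma> \<longrightarrow> (\<forall>y\<in>worlds J. val J' p (filt_class m J \<Sigma> y) = val J p y)) \<and>
     (\<forall>X\<in>props J. \<forall>x\<in>worlds J. \<forall>y\<in>worlds J.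
        acc J' (filt_prop m J \<Sigma> X) (filt_class m J \<Sigma> x) (filt_class m J \<Sigma> y) =
        (SUP (x', y') \<in> filt_class m J \<Sigma> x \<times> filt_class m J \<Sigma> y. acc J X x' y'))"

end

theory Submission
  imports Defs
begin

text \<open>
  Since the set of truth values is finite, every infimum and supremum in the semantics is
  attained. At a conditional, the accessibility degree between two classes is therefore
  the degree between some representatives \<open>x'\<close> and \<open>y'\<close>. The value of the conditional at \<open>x'\<close>
  is a lower bound for the resulting implication, and it equals the value at \<open>x\<close> because the
  conditional itself belongs to \<open>\<Sigma>\<close>. The converse inequality follows from the antitonicity of
  implication in its first argument.
\<close>

lemma finite_truth_values: "finite (truth_values m)"
  by (simp add: truth_values_def)

lemma truth_values_iff:
  "a \<in> truth_values m \<longleftrightarrow> (\<exists>k<m. a = real k / (real m - 1))"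
  by (auto simp: truth_values_def)

lemma luk_neg_truth_values:
  assumes "m \<ge> 2" "a \<in> truth_values m"
  shows "luk_neg a \<in> truth_values m"
proof -
  obtain k where k: "k < m" "a = real k / (real m - 1)"
    using assms(2) by (auto simp: truth_values_iff)
  have "luk_neg a = real (m - 1 - k) / (real m - 1)"
    using k assms(1) by (simp add: luk_neg_def field_simps of_nat_diff)
  moreover have "m - 1 - k < m"
    using assms(1) by simp
  ultimately show ?thesis
    unfolding truth_values_iff by blast
qed

text \<open>For numerators \<open>k\<close> and \<open>l\<close>, truncation at 1 takes effect when
  \<open>k \<le> l\<close>; otherwise the numerator of the result is \<open>m - 1 - k + l\<close>,
  where the natural subtraction is exact because \<open>k < m\<close>.\<close>

lemma luk_imp_truth_values:
  assumes "m \<ge> 2" "a \<in> truth_values m" "b \<in> truth_values m"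
  shows "luk_imp a b \<in> truth_values m"
proof -
  obtain k l where k: "k < m" "a = real k / (real m - 1)" and l: "l < m" "b = real l / (real m - 1)"
    using assms(2,3) by (auto simp: truth_values_iff)
  have pos: "real m - 1 > 0"
    using assms(1) by simp
  show ?thesis
  proof (cases "k \<le> l")
    case True
    then have "a \<le> b"
      using k l pos by (simp add: divide_right_mono)
    then have "luk_imp a b = real (m - 1) / (real m - 1)"
      using assms(1) by (simp add: luk_imp_def of_nat_diff)
    moreover have "m - 1 < m"
      using assms(1) by simp
    ultimately show ?thesis
      unfolding truth_values_iff by blast
  next
    case False
    then have "b \<le> a"
      using k l pos by (simp add: divide_right_mono)
    then have "luk_imp a b = 1 - a + b"
      by (simp add: luk_imp_def)
    also have "\<dots> = real (m - 1 - k + l) / (real m - 1)"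
      using k l pos by (simp add: field_simps of_nat_diff)
    finally have "luk_imp a b = real (m - 1 - k + l) / (real m - 1)" .
    moreover have "m - 1 - k + l < m"
      using False k by simp
    ultimately show ?thesis
      unfolding truth_values_iff by blast
  qed
qed

lemma luk_imp_antimono: "a \<le> a' \<Longrightarrow> luk_imp a' b \<le> luk_imp a b"
  by (auto simp: luk_imp_def)

lemma Inf_truth_values:
  assumes "A \<subseteq> truth_values m" "A \<noteq> {}"
  shows "Inf A \<in> truth_values m"
proof -
  have "finite A"
    using assms(1) finite_truth_values by (rule finite_subset)
  then have "Inf A \<in> A"
    using assms(2) by (simp add: cInf_eq_Min)
  then show ?thesis
    using assms(1) by blast
qed

lemma Sup_truth_values_attained:
  assumes "A \<subseteq> truth_values m" "A \<noteq> {}"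
  shows "Sup A \<in> A"
  using assms finite_subset[OF assms(1) finite_truth_values] Max_in[of A]
  by (auto simp: cSup_eq_Max)

lemma bdd_truth_values:
  assumes "A \<subseteq> truth_values m"
  shows "bdd_below A" "bdd_above A"
  using finite_subset[OF assms finite_truth_values] by auto

lemma lcr_model_acc:
  assumes "lcr_model m J" "x \<in> worlds J" "y \<in> worlds J"
  shows "acc J (truth_prop m J \<phi>) x y \<in> truth_values m"
  using assms by (simp add: lcr_model_def lcr_structure_def)

text \<open>Phrasing the index through \<open>truth_prop\<close> lets membership in
  \<open>props\<close> and the filtration conditions apply to it directly.\<close>

lemma eval_Cond:
  "eval m J (Cond \<phi> \<psi>) x =
     (INF y\<in>worlds J. luk_imp (acc J (truth_prop m J \<phi>) x y) (eval m J \<psi> y))"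
  by (simp add: truth_prop_def)

lemma eval_truth_values:
  assumes "m \<ge> 2" "lcr_model m J" "x \<in> worlds J"
  shows "eval m J \<phi> x \<in> truth_values m"
  using assms(3)
proof (induction \<phi> arbitrary: x)
  case (Var p)
  then show ?case
    using assms(2) by (simp add: lcr_model_def lcr_structure_def)
next
  case (Neg \<phi>)
  then show ?case
    using assms(1) by (simp add: luk_neg_truth_values)
next
  case (Imp \<phi> \<psi>)
  then show ?case
    using assms(1) by (simp add: luk_imp_truth_values)
next
  case (Cond \<phi> \<psi>)
  show ?case
    unfolding eval_Cond
  proof (rule Inf_truth_values)
    show "(\<lambda>y. luk_imp (acc J (truth_prop m J \<phi>) x y) (eval m J \<psi> y)) ` worlds J
        \<subseteq> truth_values m"
      using Cond lcr_model_acc[OF assms(2)] luk_imp_truth_values[OF assms(1)] by blast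
  qed (use Cond.prems in blast)
qed

text \<open>The relation \<open>filt_rel\<close> tests values only against members of
  \<open>truth_values m\<close>. Every value is itself such a member, so choosing it as the test
  value turns the equivalences into equality.\<close>

lemma mem_filt_class_iff:
  assumes "m \<ge> 2" "lcr_model m J" "x \<in> worlds J"
  shows "y \<in> filt_class m J \<Sigma> x \<longleftrightarrow>
    y \<in> worlds J \<and> (\<forall>\<phi>\<in>\<Sigma>. eval m J \<phi> y = eval m J \<phi> x)"
  using assms eval_truth_values[OF assms] by (auto simp: filt_class_def filt_rel_def)

lemma filtration_worlds:
  assumes "filtration m J \<Sigma> J'"
  shows "worlds J' = filt_class m J \<Sigma> ` worlds J"
  using assms by (auto simp: filtration_def quotient_def filt_class_def)

text \<open>Every world of \<open>J'\<close> is the class of a world of \<open>J\<close>, so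
  agreement on \<open>\<phi>\<close> makes each level in \<open>J'\<close> the image of the same
  level in \<open>J\<close>. Agreement is a hypothesis so that the lemma can serve inside the
  induction as well as after it.\<close>

lemma filt_prop_truth_prop:
  assumes "filtration m J \<Sigma> J'"
    and "\<And>x. x \<in> worlds J \<Longrightarrow> eval m J' \<phi> (filt_class m J \<Sigma> x) = eval m J \<phi> x"
  shows "filt_prop m J \<Sigma> (truth_prop m J \<phi>) = truth_prop m J' \<phi>"
  using assms(2)
  by (auto simp: filt_prop_def truth_prop_def levels_def filtration_worlds[OF assms(1)])

lemma filtration_eval_Cond:
  assumes m: "m \<ge> 2" and J: "lcr_model m J" and filt: "filtration m J \<Sigma> J'"
    and mem: "Cond \<phi> \<psi> \<in> \<Sigma>" "\<psi> \<in> \<Sigma>"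
    and IH: "\<And>y. y \<in> worlds J \<Longrightarrow> eval m J' \<phi> (filt_class m J \<Sigma> y) = eval m J \<phi> y"
      "\<And>y. y \<in> worlds J \<Longrightarrow> eval m J' \<psi> (filt_class m J \<Sigma> y) = eval m J \<psi> y"
    and x: "x \<in> worlds J"
  shows "eval m J' (Cond \<phi> \<psi>) (filt_class m J \<Sigma> x) = eval m J (Cond \<phi> \<psi>) x"
proof -
  let ?c = "filt_class m J \<Sigma>"
  define F where "F x y = luk_imp (acc J (truth_prop m J \<phi>) x y) (eval m J \<psi> y)" for x y
  \<comment> \<open>The degrees between representatives of the classes of the fixed \<open>x\<close>
    and of \<open>y\<close>; their supremum is the degree in the filtration.\<close>
  define S where "S y = (\<lambda>(x', y'). acc J (truth_prop m J \<phi>) x' y') ` (?c x \<times> ?c y)" for y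
  note class_iff = mem_filt_class_iff[OF m J]
  have F_bdd: "bdd_below (F x ` worlds J)" if "x \<in> worlds J" for x
    unfolding F_def
    by (rule bdd_truth_values(1)[where m = m])
      (use that luk_imp_truth_values[OF m] lcr_model_acc[OF J] eval_truth_values[OF m J] in blast)
  have eval_F: "eval m J (Cond \<phi> \<psi>) x = (INF y\<in>worlds J. F x y)" for x
    by (simp only: eval_Cond F_def)
  have S_sub: "S y \<subseteq> truth_values m" if "y \<in> worlds J" for y
    using that x by (auto simp: S_def class_iff intro!: lcr_model_acc[OF J])
  have S_mem: "acc J (truth_prop m J \<phi>) x y \<in> S y" if "y \<in> worlds J" for y
    using that x by (force simp: S_def class_iff)
  define G where "G y = luk_imp (Sup (S y)) (eval m J \<psi> y)" for y
  \<comment> \<open>The filtration fixes degrees at indices of the form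
    \<open>filt_prop m J \<Sigma> X\<close>, while evaluation in \<open>J'\<close> consults
    \<open>truth_prop m J' \<phi>\<close>. The induction hypothesis for the antecedent identifies
    the two.\<close>
  have acc': "acc J' (truth_prop m J' \<phi>) (?c x) (?c y) = Sup (S y)" if "y \<in> worlds J" for y
  proof -
    have "truth_prop m J' \<phi> = filt_prop m J \<Sigma> (truth_prop m J \<phi>)"
      using filt_prop_truth_prop[OF filt IH(1)] by simp
    then show ?thesis
      using filt J x that by (simp add: filtration_def lcr_model_def S_def)
  qed
  \<comment> \<open>The infimum over classes is reindexed by representatives.\<close>
  have eval_G: "eval m J' (Cond \<phi> \<psi>) (?c x) = (INF y\<in>worlds J. G y)"
    unfolding eval_Cond filtration_worlds[OF filt] image_image
    by (intro arg_cong[where f = Inf] image_cong) (simp_all add: G_def acc' IH(2))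
  have G_lower: "eval m J (Cond \<phi> \<psi>) x \<le> G y" if y: "y \<in> worlds J" for y
  proof -
    have "Sup (S y) \<in> S y"
      using S_sub[OF y] S_mem[OF y] by (intro Sup_truth_values_attained) auto
    then obtain x' y' where xy': "x' \<in> ?c x" "y' \<in> ?c y"
      and sup: "Sup (S y) = acc J (truth_prop m J \<phi>) x' y'"
      by (auto simp: S_def)
    have w: "x' \<in> worlds J" "y' \<in> worlds J"
      using xy' x y by (auto simp: class_iff)
    have "eval m J (Cond \<phi> \<psi>) x = eval m J (Cond \<phi> \<psi>) x'"
      \<comment> \<open>Restricting the simplifier keeps the conditional folded, so that its
        membership in \<open>\<Sigma>\<close> can be used.\<close>
      using xy'(1) mem(1) x by (auto simp only: class_iff)
    also have "\<dots> \<le> F x' y'"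
      unfolding eval_F using w by (intro cINF_lower F_bdd)
    also have "eval m J \<psi> y' = eval m J \<psi> y"
      using xy'(2) mem(2) y by (auto simp: class_iff)
    then have "F x' y' = G y"
      by (simp add: F_def G_def sup)
    finally show ?thesis .
  qed
  \<comment> \<open>The pair of \<open>x\<close> and \<open>y\<close> themselves contributes to the
    supremum.\<close>
  have G_le: "G y \<le> F x y" if "y \<in> worlds J" for y
    unfolding G_def F_def using that S_mem S_sub
    by (intro luk_imp_antimono cSup_upper bdd_truth_values(2)) auto
  show ?thesis
  proof (rule antisym)
    have "bdd_below (G ` worlds J)"
      using G_lower by (rule bdd_belowI2)
    then show "eval m J' (Cond \<phi> \<psi>) (?c x) \<le> eval m J (Cond \<phi> \<psi>) x"
      unfolding eval_G eval_F using x G_le by (intro cINF_mono) auto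
    show "eval m J (Cond \<phi> \<psi>) x \<le> eval m J' (Cond \<phi> \<psi>) (?c x)"
      unfolding eval_G using x G_lower by (intro cINF_greatest) auto
  qed
qed

lemma subformulae_refl: "\<phi> \<in> subformulae \<phi>"
  by (cases \<phi>) auto

lemma filtration_eval:
  assumes "m \<ge> 2" "subformula_closed \<Sigma>" "lcr_model m J" "filtration m J \<Sigma> J'"
    and "\<phi> \<in> \<Sigma>" "x \<in> worlds J"
  shows "eval m J' \<phi> (filt_class m J \<Sigma> x) = eval m J \<phi> x"
  using assms(5,6)
\<comment> \<open>A conditional depends on its components at all worlds, so the world must be
  generalized.\<close>
proof (induction \<phi> arbitrary: x)
  case (Var p)
  then show ?case
    using assms(4) by (simp add: filtration_def)
next
  case (Neg \<phi>)
  then have "\<phi> \<in> \<Sigma>"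
    using assms(2) subformulae_refl by (fastforce simp: subformula_closed_def)
  with Neg show ?case
    by simp
next
  case (Imp \<phi> \<psi>)
  then have "\<phi> \<in> \<Sigma>" "\<psi> \<in> \<Sigma>"
    using assms(2) subformulae_refl by (fastforce simp: subformula_closed_def)+
  with Imp show ?case
    by simp
next
  case (Cond \<phi> \<psi>)
  then have "\<phi> \<in> \<Sigma>" "\<psi> \<in> \<Sigma>"
    using assms(2) subformulae_refl by (fastforce simp: subformula_closed_def)+
  with Cond show ?case
    using assms by (intro filtration_eval_Cond) auto
qed

theorem theorem3p2:
  fixes m :: nat
    and \<Sigma> :: "('p :: countable) form set"
    and J :: "('p, 'w) kripke"
    and J' :: "('p, 'w set) kripke"
  assumes "m \<ge> 2"
    and "subformula_closed \<Sigma>"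
    and "lcr_model m J"
    and "filtration m J \<Sigma> J'"
  shows "(\<forall>\<phi>\<in>\<Sigma>. \<forall>x\<in>worlds J. \<forall>a\<in>truth_values m.
            eval m J \<phi> x = a \<longleftrightarrow> eval m J' \<phi> (filt_class m J \<Sigma> x) = a) \<and>
         (\<forall>\<phi>\<in>\<Sigma>. filt_prop m J \<Sigma> (truth_prop m J \<phi>) = truth_prop m J' \<phi>)"
  using filtration_eval[OF assms] filt_prop_truth_prop[OF assms(4)] by simp

end
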